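(* Let $G$ and $G'$ be two connected $\{1,3\}$-graphs, each with at least one vertex of degree three, with the same number of vertices and the same number $m$ of edges. Then there are a dissection of $\mathcal{P}_G$ into finitely many smaller polytopes $\mathcal{P}_G^1,\ldots,\mathcal{P}_G^k$ and affine unimodular transformations $U^1,\ldots,U^k$ of $\mathbb{R}^m$ such that $$\mathcal{P}_{G'} = U^1(\mathcal{P}_G^1)\cup\cdots\cup U^k(\mathcal{P}_G^k).$$
   Context: Graphs are finite and may have loops and parallel edges; a loop contributes 2 to the degree. A $\{1,3\}$-graph is a graph all of whose vertices have degree one or three. For a $\{1,3\}$-graph $G=(V,E)$ with $E=\{1,\ldots,m\}$, the polytope $\mathcal{P}_G\subseteq\mathbb{R}^m$ is the set of all $w=(w_1,\ldots,w_m)\in\mathbb{R}^m$ such that, for every degree three vertex $v$, with incident edges $a,b,c$ (a loop at $v$ being listed twice), $$w_a+w_b+w_c\le 1,\quad w_a\le w_b+w_c,\quad w_b\le w_a+w_c,\quad w_c\le w_a+w_b.$$ A dissection of a polytope $\mathcal{P}$ is a finite family of polytopes with pairwise disjoint interiors whose union is $\mathcal{P}$. An integral matrix is unimodular if its determinant is $\pm1$. An affine unimodular transformation of $\mathbb{R}^m$ is a map $x\mapsto Ux+b$ with $U$ an $m\times m$ unimodular (integral) matrix and $b\in\mathbb{R}^m$ a real vector. *)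

theory Defs
  imports "HOL-Analysis.Analysis" "HOL-Library.Multiset" "HOL-Library.Disjoint_Sets"
begin

text \<open>Undirected multigraphs. The edge set is the whole (finite) type \<open>'e\<close>, so that edge
  weightings are vectors in \<^typ>\<open>real ^ 'e\<close>. The ends of an edge form a multiset of size two;
  a loop at \<open>v\<close> has ends \<open>{#v, v#}\<close>.\<close>

record ('v, 'e) mgraph =
  verts :: "'v set"
  ends :: "'e \<Rightarrow> 'v multiset"

definition wf_mgraph :: "('v, 'e::finite) mgraph \<Rightarrow> bool" where
  "wf_mgraph G \<longleftrightarrow>
     finite (verts G) \<and> (\<forall>e. size (ends G e) = 2 \<and> set_mset (ends G e) \<subseteq> verts G)"

text \<open>Each edge occurs here as often as \<open>v\<close> occurs among its ends, hence a loop at \<open>v\<close> twice.\<close>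

definition incident_edges :: "('v, 'e::finite) mgraph \<Rightarrow> 'v \<Rightarrow> 'e multiset" where
  "incident_edges G v = (\<Sum>e\<in>UNIV. replicate_mset (count (ends G e) v) e)"

definition vertex_degree :: "('v, 'e::finite) mgraph \<Rightarrow> 'v \<Rightarrow> nat" where
  "vertex_degree G v = size (incident_edges G v)"

definition adjacency :: "('v, 'e::finite) mgraph \<Rightarrow> ('v \<times> 'v) set" where
  "adjacency G = {(u, v). \<exists>e. ends G e = {#u, v#}}"

definition connected_mgraph :: "('v, 'e::finite) mgraph \<Rightarrow> bool" where
  "connected_mgraph G \<longleftrightarrow>
     verts G \<noteq> {} \<and> (\<forall>u\<in>verts G. \<forall>v\<in>verts G. (u, v) \<in> (adjacency G)\<^sup>*)"

definition one_three_graph :: "('v, 'e::finite) mgraph \<Rightarrow> bool" where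
  "one_three_graph G \<longleftrightarrow>
     wf_mgraph G \<and> (\<forall>v\<in>verts G. vertex_degree G v = 1 \<or> vertex_degree G v = 3)"

definition graph_polytope :: "('v, 'e::finite) mgraph \<Rightarrow> (real ^ 'e) set" where
  "graph_polytope G =
     {w. \<forall>v\<in>verts G. \<forall>a b c. incident_edges G v = {#a, b, c#} \<longrightarrow>
           w $ a + w $ b + w $ c \<le> 1 \<and>
           w $ a \<le> w $ b + w $ c \<and> w $ b \<le> w $ a + w $ c \<and> w $ c \<le> w $ a + w $ b}"

definition dissection :: "'i set \<Rightarrow> ('i \<Rightarrow> 'a::euclidean_space set) \<Rightarrow> 'a set \<Rightarrow> bool" where
  "dissection I Q S \<longleftrightarrow>
     finite I \<and> (\<forall>i\<in>I. polytope (Q i)) \<and>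
     disjoint_family_on (\<lambda>i. interior (Q i)) I \<and> (\<Union>i\<in>I. Q i) = S"

definition unimodular :: "real ^ 'n ^ 'n \<Rightarrow> bool" where
  "unimodular A \<longleftrightarrow> (\<forall>i j. A $ i $ j \<in> \<int>) \<and> (det A = 1 \<or> det A = -1)"

definition affine_unimodular :: "(real ^ 'n \<Rightarrow> real ^ 'n) \<Rightarrow> bool" where
  "affine_unimodular f \<longleftrightarrow> (\<exists>A b. unimodular A \<and> f = (\<lambda>x. A *v x + b))"

end

theory Submission imports Defs begin

text \<open>
  The polytope of a graph depends only on the multiset of the edge triples at its degree three
  vertices. The proof joins two such systems of triples by a chain of local moves, each of which
  changes the polytope by a piecewise affine unimodular map.

  The local move is the flip of an edge \<open>e\<close> that joins two vertices with triples \<open>{e, a, b}\<close> and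
  \<open>{e, c, d}\<close>: they are regrouped as \<open>{e, a, c}\<close> and \<open>{e, b, d}\<close>. For fixed weights of the other
  edges, the admissible weights of \<open>e\<close> form an interval whose lower end is
  \<open>max \<bar>a - b\<bar> \<bar>c - d\<bar>\<close>. Its length is a symmetric function of \<open>a, b, c, d\<close>, namely, with
  \<open>s = a + b + c + d\<close>, the least of the numbers \<open>2x\<close>, \<open>s - 2x\<close>, \<open>1 - 2x\<close> and \<open>1 - s + 2x\<close> for \<open>x\<close> among
  \<open>a, b, c, d\<close> (an empty interval if this is negative). So the interval after the
  flip is a translate of the one before, by
  \<open>max \<bar>a - c\<bar> \<bar>b - d\<bar> - max \<bar>a - b\<bar> \<bar>c - d\<bar>\<close>. Where both maxima are attained by fixed integral
  linear forms, this translation of the coordinate \<open>e\<close> is an integral shear, and the regions where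
  this happens dissect the polytope (\<open>scissors_piecewise_shear\<close>, \<open>equidissectable_interchange\<close>).

  To see that flips suffice, bring every connected system into the shape of a comb, a tree whose
  internal edges form a path and whose remaining edge ends hang off this path; an edge that closes a
  cycle appears as two ends with the same label. A flip of an internal edge exchanges two
  neighbouring ends, so the ends can be permuted at will (\<open>equidissectable_comb_permute\<close>). A comb
  that is part of a connected system has an end in common with one of the triples outside; once this
  end is moved to the front, the triple extends the comb (\<open>partial_comb\<close>). Finally, two
  combs with equally many triples on the same edge set have equally many labels that occur twice
  among the ends and equally many that occur once, so a permutation of the edges, which acts on the
  polytopes by a unimodular map, and a permutation of the ends turn one into the other
  (\<open>equidissectable_combs\<close>). The number of triples is determined by the numbers of vertices and
  edges (\<open>size_triples\<close>).
\<close>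

section \<open>Piecewise affine unimodular maps\<close>

text \<open>The relation is read from left to right: the images in \<open>Q\<close> may overlap. This makes it closed
  under composition for arbitrary sets \<open>Q\<close>; symmetry is obtained later from the symmetry of the
  moves.\<close>

definition scissors :: "(real ^ 'm) set \<Rightarrow> (real ^ 'm) set \<Rightarrow> bool" where
  "scissors P Q \<longleftrightarrow>
     (\<exists>(k::nat) (R :: nat \<Rightarrow> (real ^ 'm) set) (U :: nat \<Rightarrow> real ^ 'm \<Rightarrow> real ^ 'm).
        dissection {1..k} R P \<and> (\<forall>i\<in>{1..k}. affine_unimodular (U i)) \<and>
        Q = (\<Union>i\<in>{1..k}. U i ` R i))"

lemma scissorsI:
  fixes R :: "'i \<Rightarrow> (real ^ 'm) set"
  assumes D: "dissection I R P" and U: "\<And>i. i \<in> I \<Longrightarrow> affine_unimodular (U i)"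
    and Q: "Q = (\<Union>i\<in>I. U i ` R i)"
  shows "scissors P Q"
proof -
  have "finite I" using D by (simp add: dissection_def)
  then obtain h where h: "bij_betw h {1..card I} I"
    using ex_bij_betw_nat_finite_1 by blast
  have im: "h ` {1..card I} = I" and inj: "inj_on h {1..card I}"
    using h by (auto simp: bij_betw_def)
  have "disjoint_family_on (\<lambda>i. interior (R (h i))) {1..card I}"
    unfolding disjoint_family_on_def
  proof (intro ballI impI)
    fix i j assume "i \<in> {1..card I}" "j \<in> {1..card I}" "i \<noteq> j"
    with inj im have "h i \<noteq> h j" "h i \<in> I" "h j \<in> I" by (auto dest: inj_onD)
    with D show "interior (R (h i)) \<inter> interior (R (h j)) = {}"
      unfolding dissection_def disjoint_family_on_def by blast
  qed
  moreover have "polytope (R (h i))" if "i \<in> {1..card I}" for i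
    using D im that by (auto simp: dissection_def)
  moreover have "(\<Union>i\<in>h ` {1..card I}. R i) = P"
    unfolding im using D by (simp add: dissection_def)
  ultimately have "dissection {1..card I} (R \<circ> h) P"
    using \<open>finite I\<close> by (simp add: dissection_def image_image)
  moreover have "\<forall>i\<in>{1..card I}. affine_unimodular ((U \<circ> h) i)"
    using U im by auto
  moreover have "Q = (\<Union>i\<in>{1..card I}. (U \<circ> h) i ` (R \<circ> h) i)"
  proof -
    have "Q = (\<Union>i\<in>h ` {1..card I}. U i ` R i)" unfolding im by (rule Q)
    then show ?thesis by (simp only: image_image comp_apply)
  qed
  ultimately show ?thesis unfolding scissors_def
    by (intro exI[of _ "card I"] exI[of _ "R \<circ> h"] exI[of _ "U \<circ> h"] conjI)
qed

lemma affine_unimodular_matrix: "unimodular A \<Longrightarrow> affine_unimodular ((*v) A)"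
  unfolding affine_unimodular_def by (rule exI[of _ A], rule exI[of _ 0]) auto

lemma affine_unimodular_comp:
  assumes "affine_unimodular f" "affine_unimodular g"
  shows "affine_unimodular (f \<circ> g)"
proof -
  obtain A b where A: "unimodular A" and f: "f = (\<lambda>x. A *v x + b)"
    using assms(1) unfolding affine_unimodular_def by blast
  obtain B c where B: "unimodular B" and g: "g = (\<lambda>x. B *v x + c)"
    using assms(2) unfolding affine_unimodular_def by blast
  have "det (A ** B) = 1 \<or> det (A ** B) = -1"
    using A B by (auto simp: unimodular_def det_mul)
  then have "unimodular (A ** B)"
    using A B by (auto simp: unimodular_def matrix_matrix_mult_def intro!: Ints_sum Ints_mult)
  moreover have "f \<circ> g = (\<lambda>x. (A ** B) *v x + (A *v c + b))"
    by (auto simp: f g fun_eq_iff matrix_vector_right_distrib matrix_vector_mul_assoc algebra_simps)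
  ultimately show ?thesis unfolding affine_unimodular_def by blast
qed

text \<open>The inverse is affine as well, so preimages of polytopes are polytopes and interiors pull back to
  interiors.\<close>

lemma affine_unimodular_invertible:
  assumes "affine_unimodular f"
  obtains B c where "\<And>x. B *v f x + c = x" "\<And>y. f (B *v y + c) = y"
proof -
  obtain A b where A: "unimodular A" and f: "f = (\<lambda>x. A *v x + b)"
    using assms unfolding affine_unimodular_def by blast
  have "invertible A" using A by (auto simp: unimodular_def invertible_det_nz)
  then obtain B where AB: "A ** B = mat 1" "B ** A = mat 1" by (auto simp: invertible_def)
  show ?thesis
  proof (rule that)
    show "B *v f x + - (B *v b) = x" for x
      by (simp add: f matrix_vector_right_distrib matrix_vector_mul_assoc AB)
    show "f (B *v y + - (B *v b)) = y" for y
      by (simp add: f matrix_vector_mult_diff_distrib matrix_vector_mul_assoc AB)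
  qed
qed

lemma polytope_vimage_affine_unimodular:
  assumes f: "affine_unimodular f" and "polytope Q"
  shows "polytope (f -` Q)"
proof -
  obtain B c where 1: "\<And>x. B *v f x + c = x" and 2: "\<And>y. f (B *v y + c) = y"
    using affine_unimodular_invertible[OF f] by metis
  have "f -` Q = (+) c ` ((*v) B ` Q)"
  proof (intro equalityI subsetI)
    fix x assume "x \<in> f -` Q"
    then show "x \<in> (+) c ` ((*v) B ` Q)"
      using 1[of x] by (metis add.commute image_eqI vimageD)
  next
    fix x assume "x \<in> (+) c ` ((*v) B ` Q)"
    then obtain y where "y \<in> Q" "x = B *v y + c" by (auto simp: add.commute)
    then show "x \<in> f -` Q" using 2[of y] by simp
  qed
  then show ?thesis
    using assms(2) by (simp add: polytope_translation_eq polytope_linear_image)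
qed

lemma interior_vimage_affine_unimodular:
  assumes f: "affine_unimodular f"
  shows "f ` interior (f -` Q) \<subseteq> interior Q"
proof (rule interior_maximal)
  show "f ` interior (f -` Q) \<subseteq> Q" using interior_subset by fastforce
  obtain B c where 1: "\<And>x. B *v f x + c = x" and 2: "\<And>y. f (B *v y + c) = y"
    using affine_unimodular_invertible[OF f] by metis
  let ?S = "interior (f -` Q)"
  have "f ` ?S = (\<lambda>y. B *v y + c) -` ?S"
    using 1 2 by (auto simp: image_iff) metis
  moreover have "continuous_on UNIV (\<lambda>y. B *v y + c)"
    by (intro continuous_on_add continuous_on_const linear_continuous_on
        matrix_vector_mul_bounded_linear)
  ultimately show "open (f ` ?S)" by (simp add: open_vimage)
qed

lemma scissors_refl: "polytope P \<Longrightarrow> scissors P P"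
proof (rule scissorsI[of "{()}" "\<lambda>_. P" _ "\<lambda>_. (*v) (mat 1)"])
  show "dissection {()} (\<lambda>_. P) P" if "polytope P"
    using that by (simp add: dissection_def disjoint_family_on_def)
  have "unimodular (mat 1 :: real^'m^'m)" by (simp add: unimodular_def) (simp add: mat_def)
  then show "affine_unimodular ((*v) (mat 1 :: real^'m^'m))" by (rule affine_unimodular_matrix)
qed auto

text \<open>Refine the first dissection by pulling back the second one: the pieces
  \<open>R i \<inter> U i -` T j\<close> are polytopes, and \<open>V j \<circ> U i\<close> carries them onto a cover of \<open>V j ` T j\<close>,
  since the sets \<open>U i ` R i\<close> cover \<open>T j\<close>.\<close>

lemma scissors_trans:
  assumes PQ: "scissors P Q" and QS: "scissors Q S"
  shows "scissors P S"
proof -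
  obtain k R U where *: "dissection {1..k::nat} R P \<and>
      (\<forall>i\<in>{1..k}. affine_unimodular (U i)) \<and> Q = (\<Union>i\<in>{1..k}. U i ` R i)"
    using PQ unfolding scissors_def by (elim exE)
  then have R: "dissection {1..k} R P" and Q: "Q = (\<Union>i\<in>{1..k}. U i ` R i)"
    and U: "\<And>i. i \<in> {1..k} \<Longrightarrow> affine_unimodular (U i)"
    by auto
  obtain l T V where *: "dissection {1..l::nat} T Q \<and>
      (\<forall>j\<in>{1..l}. affine_unimodular (V j)) \<and> S = (\<Union>j\<in>{1..l}. V j ` T j)"
    using QS unfolding scissors_def by (elim exE)
  then have T: "dissection {1..l} T Q" and S: "S = (\<Union>j\<in>{1..l}. V j ` T j)"
    and V: "\<And>j. j \<in> {1..l} \<Longrightarrow> affine_unimodular (V j)"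
    by auto
  define W where "W = (\<lambda>(i, j). R i \<inter> U i -` T j)"
  let ?I = "{1..k} \<times> {1..l}"
  have TQ: "(\<Union>j\<in>{1..l}. T j) = Q" and RP: "(\<Union>i\<in>{1..k}. R i) = P"
    using R T by (auto simp: dissection_def)
  have int: "interior (W (i, j)) \<inter> interior (W (i', j')) = {}"
    if ij: "(i, j) \<in> ?I" "(i', j') \<in> ?I" "(i, j) \<noteq> (i', j')" for i j i' j'
  proof (rule ccontr)
    assume "interior (W (i, j)) \<inter> interior (W (i', j')) \<noteq> {}"
    then obtain x where x: "x \<in> interior (W (i, j))" "x \<in> interior (W (i', j'))" by auto
    have "x \<in> interior (R i) \<inter> interior (R i')" using x by (auto simp: W_def)
    then have "i = i'" using R ij unfolding dissection_def disjoint_family_on_def by blast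
    have "x \<in> interior (U i -` T j)" "x \<in> interior (U i -` T j')"
      using x \<open>i = i'\<close> by (auto simp: W_def)
    then have "U i x \<in> interior (T j) \<inter> interior (T j')"
      using interior_vimage_affine_unimodular[OF U] ij by blast
    then have "j = j'" using T ij unfolding dissection_def disjoint_family_on_def by blast
    with \<open>i = i'\<close> ij show False by simp
  qed
  show ?thesis
  proof (rule scissorsI)
    show "dissection ?I W P"
      unfolding dissection_def
    proof (intro conjI ballI)
      show "polytope (W p)" if "p \<in> ?I" for p
        using that R T U unfolding W_def dissection_def
        by (auto intro!: polytope_Int polytope_vimage_affine_unimodular)
      show "disjoint_family_on (\<lambda>p. interior (W p)) ?I"
        unfolding disjoint_family_on_def
      proof (intro ballI impI)
        fix p q assume "p \<in> ?I" "q \<in> ?I" "p \<noteq> q"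
        then show "interior (W p) \<inter> interior (W q) = {}"
          using int[of "fst p" "snd p" "fst q" "snd q"] by simp
      qed
      have "x \<in> (\<Union>p\<in>?I. W p)" if xP: "x \<in> P" for x
      proof -
        obtain i where i: "i \<in> {1..k}" "x \<in> R i" using xP unfolding RP[symmetric] by blast
        then have "U i x \<in> Q" unfolding Q by blast
        then obtain j where "j \<in> {1..l}" "U i x \<in> T j" using TQ by blast
        with i have "(i, j) \<in> ?I" "x \<in> W (i, j)" by (auto simp: W_def)
        then show ?thesis by blast
      qed
      moreover have "W p \<subseteq> P" if "p \<in> ?I" for p
        using that unfolding RP[symmetric] by (auto simp: W_def)
      ultimately show "(\<Union>p\<in>?I. W p) = P" by blast
    qed simp
    show "affine_unimodular ((\<lambda>(i, j). V j \<circ> U i) p)" if "p \<in> ?I" for p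
      using that U V by (auto intro!: affine_unimodular_comp)
    show "S = (\<Union>p\<in>?I. (\<lambda>(i, j). V j \<circ> U i) p ` W p)"
    proof -
      have "V j ` T j = (\<Union>i\<in>{1..k}. (V j \<circ> U i) ` W (i, j))" if "j \<in> {1..l}" for j
      proof -
        have "T j \<subseteq> Q" using that TQ by auto
        then have "T j = (\<Union>i\<in>{1..k}. U i ` W (i, j))" unfolding Q W_def by fastforce
        then have "V j ` T j = V j ` (\<Union>i\<in>{1..k}. U i ` W (i, j))" by (rule arg_cong)
        also have "\<dots> = (\<Union>i\<in>{1..k}. (V j \<circ> U i) ` W (i, j))" by (simp add: image_UN image_comp)
        finally show ?thesis .
      qed
      then have S': "S = (\<Union>j\<in>{1..l}. \<Union>i\<in>{1..k}. (V j \<circ> U i) ` W (i, j))"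
        unfolding S by (intro SUP_cong) auto
      have "(\<Union>j\<in>J. \<Union>i\<in>I. f i j) = (\<Union>p\<in>I \<times> J. f (fst p) (snd p))"
        for I J and f :: "nat \<Rightarrow> nat \<Rightarrow> (real ^ 'm) set" by fastforce
      from this[of "\<lambda>i j. (V j \<circ> U i) ` W (i, j)"] show ?thesis
        unfolding S' by (simp only: case_prod_beta prod.collapse)
    qed
  qed
qed

section \<open>Integral shears and permutations of coordinates\<close>

text \<open>The matrix arises from the identity by adding to row \<open>e\<close> a combination of the other rows.\<close>

lemma affine_unimodular_shear:
  fixes n :: "real ^ 'm"
  assumes int: "\<And>i. n $ i \<in> \<int>" and e: "n $ e = 0"
  shows "affine_unimodular (\<lambda>w. w + (n \<bullet> w) *\<^sub>R axis e 1)"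
proof -
  let ?I = "mat 1 :: real^'m^'m"
  define S :: "real^'m^'m" where "S = (\<chi> k. if k = e then row e ?I + n else row k ?I)"
  have row: "row k ?I = axis k 1" for k
    by (auto simp: row_def mat_def axis_def vec_eq_iff)
  have "n = (\<Sum>i\<in>UNIV - {e}. n $ i *s axis i 1)"
  proof -
    have "n = (\<Sum>i\<in>UNIV. n $ i *s axis i 1)" by (simp add: basis_expansion)
    also have "\<dots> = (\<Sum>i\<in>UNIV - {e}. n $ i *s axis i 1)"
      by (rule sum.mono_neutral_right) (auto simp: e)
    finally show ?thesis .
  qed
  moreover have "\<dots> \<in> vec.span {row j ?I |j. j \<noteq> e}"
    by (rule vec.span_sum, rule vec.span_scale, rule vec.span_base) (auto simp: row)
  ultimately have "n \<in> vec.span {row j ?I |j. j \<noteq> e}" by simp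
  then have "det S = 1" using det_row_span[of n ?I e] by (simp add: S_def)
  moreover have "S $ i $ j \<in> \<int>" for i j
    using int by (auto simp: S_def row axis_def)
  ultimately have "unimodular S" by (simp add: unimodular_def)
  moreover have eq: "(\<lambda>w. w + (n \<bullet> w) *\<^sub>R axis e 1) = (*v) S"
  proof (intro ext vec_eq_iff[THEN iffD2] allI)
    fix w k
    have ne: "axis e (1::real) $ k = 0" if "k \<noteq> e" using that by (simp add: axis_def)
    show "(w + (n \<bullet> w) *\<^sub>R axis e 1) $ k = (S *v w) $ k"
      by (cases "k = e")
        (simp_all add: S_def row matrix_vector_mul_component inner_add_left inner_axis' ne)
  qed
  ultimately show "affine_unimodular (\<lambda>w. w + (n \<bullet> w) *\<^sub>R axis e 1)"
    unfolding eq by (intro affine_unimodular_matrix)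
qed

lemma interior_halfspaces_disjoint:
  fixes m n :: "'a::euclidean_space"
  assumes "m \<noteq> n" "S \<subseteq> {x. m \<bullet> x \<le> n \<bullet> x}" "T \<subseteq> {x. n \<bullet> x \<le> m \<bullet> x}"
  shows "interior S \<inter> interior T = {}"
proof -
  have "m \<bullet> x = n \<bullet> x" if "x \<in> S" "x \<in> T" for x
    using subsetD[OF assms(2) that(1)] subsetD[OF assms(3) that(2)] by simp
  then have "S \<inter> T \<subseteq> {x. (m - n) \<bullet> x = 0}" by (auto simp: inner_diff_left)
  then have "interior (S \<inter> T) \<subseteq> interior {x. (m - n) \<bullet> x = 0}" by (rule interior_mono)
  then show ?thesis using assms(1) by (simp add: interior_Int)
qed

lemma polyhedron_max_cell:
  fixes A :: "'a::euclidean_space set"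
  assumes "finite A"
  shows "polyhedron {w. \<forall>m\<in>A. m \<bullet> w \<le> n \<bullet> w}"
proof -
  have "{w. \<forall>m\<in>A. m \<bullet> w \<le> n \<bullet> w} = \<Inter>((\<lambda>m. {w. (m - n) \<bullet> w \<le> 0}) ` A)"
    by (auto simp: inner_diff_left)
  also have "polyhedron \<dots>"
    using assms by (intro polyhedron_Inter) (auto simp: polyhedron_halfspace_le)
  finally show ?thesis .
qed

text \<open>The difference of two maxima of finitely many linear forms is linear on each cell where both
  maxima are attained by a given form. Indexing the cells by the forms themselves, as sets of
  vectors, makes the forms of different cells differ, so that the cells have disjoint
  interiors.\<close>

lemma scissors_piecewise_shear:
  fixes A B :: "(real ^ 'm) set"
  assumes P: "polytope P" and fin: "finite A" "finite B" and ne: "A \<noteq> {}" "B \<noteq> {}"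
    and int: "\<And>n i. n \<in> A \<union> B \<Longrightarrow> n $ i \<in> \<int>" and e: "\<And>n. n \<in> A \<union> B \<Longrightarrow> n $ e = 0"
  shows "scissors P ((\<lambda>w. w + (Max ((\<lambda>n. n \<bullet> w) ` B) - Max ((\<lambda>n. n \<bullet> w) ` A)) *\<^sub>R axis e 1) ` P)"
    (is "scissors P (?F ` P)")
proof -
  define cell where "cell = (\<lambda>X (n :: real ^ 'm). {w. \<forall>m\<in>X. m \<bullet> w \<le> n \<bullet> w})"
  define R where "R = (\<lambda>(n, n'). P \<inter> cell A n \<inter> cell B n')"
  define U where "U = (\<lambda>(n, n') w. w + ((n' - n) \<bullet> w) *\<^sub>R axis e (1::real))"
  have cell_Max: "Max ((\<lambda>n. n \<bullet> w) ` X) = n \<bullet> w" if "finite X" "n \<in> X" "w \<in> cell X n" for X n w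
    using that by (intro Max_eqI) (auto simp: cell_def)
  have cell_ex: "\<exists>n\<in>X. w \<in> cell X n" if X: "finite X" "X \<noteq> {}" for X w
  proof -
    have "Max ((\<lambda>n. n \<bullet> w) ` X) \<in> (\<lambda>n. n \<bullet> w) ` X" using X by simp
    then obtain n where "n \<in> X" "Max ((\<lambda>n. n \<bullet> w) ` X) = n \<bullet> w" by auto
    moreover have "m \<bullet> w \<le> Max ((\<lambda>n. n \<bullet> w) ` X)" if "m \<in> X" for m using X that by simp
    ultimately show ?thesis by (auto simp: cell_def)
  qed
  have disj: "interior (R p) \<inter> interior (R q) = {}"
    if "p \<in> A \<times> B" "q \<in> A \<times> B" "p \<noteq> q" for p q
  proof (cases "fst p = fst q")
    case True
    then have "snd q \<noteq> snd p" using that by (auto simp: prod_eq_iff)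
    then show ?thesis
      by (rule interior_halfspaces_disjoint) (use that in \<open>auto simp: R_def cell_def\<close>)
  next
    case False
    then have "fst q \<noteq> fst p" by simp
    then show ?thesis
      by (rule interior_halfspaces_disjoint) (use that in \<open>auto simp: R_def cell_def\<close>)
  qed
  have UF: "U p w = ?F w" if "p \<in> A \<times> B" "w \<in> R p" for p w
    using that fin by (auto simp: U_def R_def cell_Max inner_diff_left)
  have cover: "(\<Union>p\<in>A \<times> B. R p) = P"
  proof (intro equalityI subsetI)
    fix w assume "w \<in> P"
    moreover obtain n where "n \<in> A" "w \<in> cell A n" using cell_ex fin ne by blast
    moreover obtain n' where "n' \<in> B" "w \<in> cell B n'" using cell_ex fin ne by blast
    ultimately have "w \<in> R (n, n')" "(n, n') \<in> A \<times> B" by (auto simp: R_def)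
    then show "w \<in> (\<Union>p\<in>A \<times> B. R p)" by blast
  qed (auto simp: R_def)
  show ?thesis
  proof (rule scissorsI)
    have "polytope (R p)" for p
      using P fin unfolding R_def cell_def
      by (auto split: prod.split intro!: polytope_Int_polyhedron polyhedron_max_cell)
    then show "dissection (A \<times> B) R P"
      using fin disj cover by (simp add: dissection_def disjoint_family_on_def)
    show "affine_unimodular (U p)" if "p \<in> A \<times> B" for p
      using that int e unfolding U_def
      by (auto split: prod.split intro!: affine_unimodular_shear Ints_diff)
    show "?F ` P = (\<Union>p\<in>A \<times> B. U p ` R p)"
    proof -
      have "?F ` P = (\<Union>p\<in>A \<times> B. ?F ` R p)" by (simp only: cover[symmetric] image_UN)
      also have "\<dots> = (\<Union>p\<in>A \<times> B. U p ` R p)"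
        using UF by (intro SUP_cong image_cong) auto
      finally show ?thesis .
    qed
  qed
qed

lemma scissors_permute_coordinates:
  fixes p :: "'m \<Rightarrow> 'm::finite"
  assumes P: "polytope P" and p: "p permutes UNIV"
  shows "scissors P ((\<lambda>w. \<chi> i. w $ p i) ` P)"
proof (rule scissorsI[of "{()}" "\<lambda>_. P" _ "\<lambda>_ w. \<chi> i. w $ p i"])
  show "dissection {()} (\<lambda>_. P) P"
    using P by (simp add: dissection_def disjoint_family_on_def)
  define M :: "real^'m^'m" where "M = (\<chi> i. mat 1 $ p i)"
  have "det M = of_int (sign p)" using det_permute_rows[OF p, of "mat 1 :: real^'m^'m"] by (simp add: M_def)
  then have "det M = 1 \<or> det M = -1" by (simp add: sign_def)
  moreover have "M $ i $ j \<in> \<int>" for i j by (simp add: M_def mat_def)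
  ultimately have "unimodular M" by (simp add: unimodular_def)
  moreover have eq: "(\<lambda>w. \<chi> i. w $ p i) = (*v) M"
    by (simp add: fun_eq_iff M_def matrix_vector_mult_def mat_def vec_eq_iff if_distrib if_distribR
        cong: if_cong)
  ultimately show "affine_unimodular (\<lambda>w. \<chi> i. w $ p i)" for x :: unit
    unfolding eq by (intro affine_unimodular_matrix)
qed auto

section \<open>Polytopes of systems of triples and the flip of an edge\<close>

text \<open>For a triple \<open>{a, b, c}\<close> these are the perimeter and triangle inequalities; in this form they
  need no choice of an order on the triple.\<close>

definition admissible :: "real ^ 'm \<Rightarrow> 'm multiset \<Rightarrow> bool" where
  "admissible w T \<longleftrightarrow> (\<Sum>x\<in>#T. w $ x) \<le> 1 \<and> (\<forall>x\<in>#T. 2 * w $ x \<le> (\<Sum>x\<in>#T. w $ x))"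

definition triple_polytope :: "'m multiset multiset \<Rightarrow> (real ^ 'm) set" where
  "triple_polytope S = {w. \<forall>T\<in>#S. admissible w T}"

text \<open>The triples of a connected \<open>{1,3}\<close>-graph with a vertex of degree three: an edge occurs
  twice if both of its ends have degree three and once if it leads to a leaf.\<close>

definition trivalent :: "'m multiset multiset \<Rightarrow> bool" where
  "trivalent S \<longleftrightarrow>
     (\<forall>T\<in>#S. size T = 3) \<and> (\<forall>e. 1 \<le> count (\<Sum>\<^sub># S) e \<and> count (\<Sum>\<^sub># S) e \<le> 2)"

definition equidissectable :: "'m::finite multiset multiset \<Rightarrow> 'm multiset multiset \<Rightarrow> bool" where
  "equidissectable S S' \<longleftrightarrow>
     scissors (triple_polytope S) (triple_polytope S') \<and>
     scissors (triple_polytope S') (triple_polytope S)"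

lemma equidissectable_sym: "equidissectable S S' \<Longrightarrow> equidissectable S' S"
  by (simp add: equidissectable_def)

lemma equidissectable_trans [trans]:
  "equidissectable S S' \<Longrightarrow> equidissectable S' S'' \<Longrightarrow> equidissectable S S''"
  unfolding equidissectable_def using scissors_trans by blast

lemma admissible_triple:
  "admissible w {#a, b, c#} \<longleftrightarrow>
     w $ a + w $ b + w $ c \<le> 1 \<and> w $ a \<le> w $ b + w $ c \<and> w $ b \<le> w $ a + w $ c \<and>
     w $ c \<le> w $ a + w $ b"
  by (auto simp: admissible_def algebra_simps)

lemma size_3_multiset:
  assumes "size T = 3" obtains a b c where "T = {#a, b, c#}"
proof -
  obtain a A where "T = add_mset a A" "size A = 2"
    using assms by (cases T) auto
  moreover obtain b B where "A = add_mset b B" "size B = 1"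
    using calculation(2) by (cases A) auto
  moreover obtain c where "B = {#c#}"
    using calculation(4) size_1_singleton_mset by blast
  ultimately show ?thesis using that by blast
qed

lemma admissible_bounds:
  assumes "admissible w T" "size T = 3" "x \<in># T"
  shows "0 \<le> w $ x" "w $ x \<le> 1"
proof -
  obtain a b c where "T = {#a, b, c#}" using size_3_multiset assms(2) by blast
  with assms show "0 \<le> w $ x" "w $ x \<le> 1" by (auto simp: admissible_triple)
qed

lemma polyhedron_admissible:
  fixes T :: "'m::finite multiset"
  shows "polyhedron {w. admissible w T}"
proof -
  define s :: "real ^ 'm" where "s = (\<Sum>x\<in>#T. axis x 1)"
  have s: "(\<Sum>x\<in>#T. w $ x) = s \<bullet> w" for w
    unfolding s_def by (induction T) (auto simp: inner_add_left inner_axis')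
  have "{w. admissible w T} =
      {w. s \<bullet> w \<le> 1} \<inter> \<Inter>((\<lambda>x. {w. (2 *\<^sub>R axis x 1 - s) \<bullet> w \<le> 0}) ` set_mset T)"
    by (auto simp: admissible_def s inner_diff_left inner_axis')
  also have "polyhedron \<dots>"
    by (intro polyhedron_Int polyhedron_Inter) (auto simp: polyhedron_halfspace_le)
  finally show ?thesis .
qed

text \<open>Boundedness holds because every edge occurs in a triple, whose inequalities confine its weight
  to the interval from 0 to 1.\<close>

lemma polytope_triple_polytope:
  fixes S :: "'m::finite multiset multiset"
  assumes "trivalent S"
  shows "polytope (triple_polytope S)"
proof -
  have "triple_polytope S = \<Inter>((\<lambda>T. {w. admissible w T}) ` set_mset S)"
    by (auto simp: triple_polytope_def)
  then have "polyhedron (triple_polytope S)"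
    by (auto intro!: polyhedron_Inter simp: polyhedron_admissible)
  moreover have "triple_polytope S \<subseteq> cbox 0 1"
  proof
    fix w assume w: "w \<in> triple_polytope S"
    have "0 \<le> w $ e \<and> w $ e \<le> 1" for e
    proof -
      have "e \<in># \<Sum>\<^sub># S" using assms unfolding trivalent_def by (metis count_eq_zero_iff not_one_le_zero)
      then obtain T where "T \<in># S" "e \<in># T" by auto
      moreover from this have "admissible w T" "size T = 3"
        using w assms by (auto simp: triple_polytope_def trivalent_def)
      ultimately show ?thesis using admissible_bounds by blast
    qed
    then show "w \<in> cbox 0 1" by (simp add: mem_box_cart)
  qed
  ultimately show ?thesis
    using bounded_subset[OF bounded_cbox] polytope_eq_bounded_polyhedron by blast
qed

lemma equidissectable_refl: "trivalent S \<Longrightarrow> equidissectable S S"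
  by (simp add: equidissectable_def scissors_refl polytope_triple_polytope)

text \<open>With \<open>M\<close> and \<open>M'\<close> for the lower ends of the two intervals, \<open>e' - M' = e - M \<ge> 0\<close> gives the new lower
  bounds. A new upper bound \<open>u\<close> holds because each of the four linear forms with maximum \<open>M'\<close> is at most
  \<open>u + M - e\<close>, by one old inequality and one of the forms below \<open>M\<close>.\<close>

lemma quadrilateral_flip:
  fixes a b c d e :: real
  defines "e' \<equiv> e + (max \<bar>a - c\<bar> \<bar>b - d\<bar> - max \<bar>a - b\<bar> \<bar>c - d\<bar>)"
  assumes "e + a + b \<le> 1" "e \<le> a + b" "a \<le> e + b" "b \<le> e + a"
    and "e + c + d \<le> 1" "e \<le> c + d" "c \<le> e + d" "d \<le> e + c"
  shows "e' + a + c \<le> 1 \<and> e' \<le> a + c \<and> a \<le> e' + c \<and> c \<le> e' + a \<and>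
    e' + b + d \<le> 1 \<and> e' \<le> b + d \<and> b \<le> e' + d \<and> d \<le> e' + b"
proof -
  define M where "M = max \<bar>a - b\<bar> \<bar>c - d\<bar>"
  define M' where "M' = max \<bar>a - c\<bar> \<bar>b - d\<bar>"
  have e': "e' = e + (M' - M)" by (simp add: e'_def M_def M'_def)
  have M: "a - b \<le> M" "b - a \<le> M" "c - d \<le> M" "d - c \<le> M" by (auto simp: M_def)
  have M': "a - c \<le> M'" "c - a \<le> M'" "b - d \<le> M'" "d - b \<le> M'" by (auto simp: M'_def)
  have "M \<le> e" unfolding M_def using assms by (intro max.boundedI abs_leI) auto
  moreover have "M' \<le> a + c + M - e" "M' \<le> b + d + M - e"
    "M' \<le> 1 - a - c + M - e" "M' \<le> 1 - b - d + M - e"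
    unfolding M'_def by (intro max.boundedI abs_leI; use assms(2-) M in linarith)+
  ultimately show ?thesis using M' unfolding e' by linarith
qed

definition flip :: "'m \<Rightarrow> 'm \<Rightarrow> 'm \<Rightarrow> 'm \<Rightarrow> 'm \<Rightarrow> real ^ 'm \<Rightarrow> real ^ 'm" where
  "flip e a b c d w =
     w + (max \<bar>w $ a - w $ c\<bar> \<bar>w $ b - w $ d\<bar> - max \<bar>w $ a - w $ b\<bar> \<bar>w $ c - w $ d\<bar>) *\<^sub>R axis e 1"

lemma flip_other [simp]: "x \<noteq> e \<Longrightarrow> flip e a b c d w $ x = w $ x"
  by (simp add: flip_def axis_def)

lemma flip_flip:
  assumes "e \<notin> {a, b, c, d}"
  shows "flip e a b c d (flip e a c b d w) = w"
proof -
  have "a \<noteq> e" "b \<noteq> e" "c \<noteq> e" "d \<noteq> e" using assms by auto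
  then show ?thesis
    by (simp add: flip_def[of e a b c d]) (simp add: flip_def algebra_simps flip: scaleR_left_distrib)
qed

text \<open>Triples other than the two at \<open>e\<close> avoid \<open>e\<close> and do not notice the flip.\<close>

lemma flip_triple_polytope:
  assumes e: "e \<notin> {a, b, c, d}" "e \<notin># \<Sum>\<^sub># X"
    and w: "w \<in> triple_polytope (add_mset {#e, a, b#} (add_mset {#e, c, d#} X))"
  shows "flip e a b c d w \<in> triple_polytope (add_mset {#e, a, c#} (add_mset {#e, b, d#} X))"
proof -
  have adm: "admissible (flip e a b c d w) T" if "T \<in># X" for T
  proof -
    have "x \<noteq> e" if "x \<in># T" for x using e that \<open>T \<in># X\<close> by auto
    then have "image_mset (($) (flip e a b c d w)) T = image_mset (($) w) T"
      "\<forall>x\<in>#T. flip e a b c d w $ x = w $ x"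
      by (auto intro: image_mset_cong)
    moreover have "admissible w T" using w that by (simp add: triple_polytope_def)
    ultimately show ?thesis by (simp add: admissible_def)
  qed
  define e' where "e' = flip e a b c d w $ e"
  have "e' + w $ a + w $ c \<le> 1 \<and> e' \<le> w $ a + w $ c \<and> w $ a \<le> e' + w $ c \<and> w $ c \<le> e' + w $ a \<and>
    e' + w $ b + w $ d \<le> 1 \<and> e' \<le> w $ b + w $ d \<and> w $ b \<le> e' + w $ d \<and> w $ d \<le> e' + w $ b"
    unfolding e'_def flip_def vector_add_component vector_scaleR_component axis_nth
      real_scaleR_def mult_1_right
    by (rule quadrilateral_flip) (use w in \<open>simp_all add: triple_polytope_def admissible_triple\<close>)
  moreover have "a \<noteq> e" "b \<noteq> e" "c \<noteq> e" "d \<noteq> e" using e by auto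
  ultimately have "admissible (flip e a b c d w) {#e, a, c#}" "admissible (flip e a b c d w) {#e, b, d#}"
    unfolding admissible_triple by (simp_all only: flip_other e'_def conj_assoc simp_thms)
  with adm show ?thesis by (simp add: triple_polytope_def)
qed

lemma scissors_flip:
  assumes "polytope P" and e: "e \<notin> {a, b, c, d}"
  shows "scissors P (flip e a b c d ` P)"
proof -
  define N :: "'a \<Rightarrow> 'a \<Rightarrow> 'a \<Rightarrow> 'a \<Rightarrow> (real ^ 'a) set" where
    "N = (\<lambda>a b c d. {axis a 1 - axis b 1, axis b 1 - axis a 1, axis c 1 - axis d 1, axis d 1 - axis c 1})"
  have Max: "Max ((\<lambda>n. n \<bullet> w) ` N a b c d) = max \<bar>w $ a - w $ b\<bar> \<bar>w $ c - w $ d\<bar>" for a b c d w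
    by (simp add: N_def inner_diff_left inner_axis')
  have "scissors P ((\<lambda>w. w + (Max ((\<lambda>n. n \<bullet> w) ` N a c b d) -
      Max ((\<lambda>n. n \<bullet> w) ` N a b c d)) *\<^sub>R axis e 1) ` P)"
    using assms(1) by (rule scissors_piecewise_shear) (use e in \<open>auto simp: N_def axis_def\<close>)
  then show ?thesis by (simp add: Max flip_def[abs_def])
qed

text \<open>An edge has only two ends, so an edge that joins two vertices of degree three occurs in no further
  triple, and the flip applies; the flip with \<open>b\<close> and \<open>c\<close> exchanged is its inverse.\<close>

lemma scissors_interchange:
  assumes S: "trivalent (add_mset {#e, a, b#} (add_mset {#e, c, d#} X))" (is "trivalent ?S")
  shows "scissors (triple_polytope (add_mset {#e, a, b#} (add_mset {#e, c, d#} X)))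
    (triple_polytope (add_mset {#e, a, c#} (add_mset {#e, b, d#} X)))" (is "scissors ?P ?Q")
proof -
  have "count (\<Sum>\<^sub># ?S) e \<le> 2" using S unfolding trivalent_def by blast
  then have "e \<notin> {a, b, c, d}" "count (\<Sum>\<^sub># X) e = 0" by (auto split: if_splits)
  then have e: "e \<notin> {a, b, c, d}" "e \<notin># \<Sum>\<^sub># X" by (simp_all add: count_eq_zero_iff)
  then have "flip e a b c d ` ?P = ?Q"
  proof (intro equalityI subsetI)
    fix w assume "w \<in> ?Q"
    then have "flip e a c b d w \<in> ?P" using e by (intro flip_triple_polytope) auto
    then have "flip e a b c d (flip e a c b d w) \<in> flip e a b c d ` ?P" by (rule imageI)
    then show "w \<in> flip e a b c d ` ?P" using e by (simp add: flip_flip)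
  next
    fix w assume "w \<in> flip e a b c d ` ?P"
    then obtain u where "u \<in> ?P" "w = flip e a b c d u" by (rule imageE)
    then show "w \<in> ?Q" using flip_triple_polytope[OF e] by simp
  qed
  moreover have "scissors ?P (flip e a b c d ` ?P)"
    using S e by (intro scissors_flip polytope_triple_polytope)
  ultimately show ?thesis by (simp only:)
qed

lemma trivalent_cong:
  assumes "trivalent S" "\<Sum>\<^sub># S' = \<Sum>\<^sub># S" "\<And>T. T \<in># S' \<Longrightarrow> size T = 3"
  shows "trivalent S'"
  using assms by (simp add: trivalent_def)

lemma equidissectable_interchange:
  assumes S: "trivalent (add_mset {#e, a, b#} (add_mset {#e, c, d#} X))" (is "trivalent ?S")
  shows "equidissectable (add_mset {#e, a, b#} (add_mset {#e, c, d#} X))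
    (add_mset {#e, a, c#} (add_mset {#e, b, d#} X))" (is "equidissectable ?S ?S'")
proof -
  have "trivalent ?S'"
  proof (rule trivalent_cong[OF S])
    show "\<Sum>\<^sub># ?S' = \<Sum>\<^sub># ?S" by (simp add: add_mset_commute)
    have "\<forall>T\<in>#?S. size T = 3" using S unfolding trivalent_def by (rule conjunct1)
    then show "size T = 3" if "T \<in># ?S'" for T using that by auto
  qed
  then show ?thesis
    using S unfolding equidissectable_def by (intro conjI scissors_interchange)
qed

text \<open>Renaming the edges permutes the coordinates of the polytope.\<close>

lemma scissors_relabel:
  fixes S :: "'m::finite multiset multiset"
  assumes p: "p permutes UNIV" and S': "trivalent (image_mset (image_mset p) S)"
  shows "scissors (triple_polytope (image_mset (image_mset p) S)) (triple_polytope S)"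
proof -
  let ?g = "\<lambda>w :: real ^ 'm. \<chi> i. w $ p i"
  have adm: "admissible w (image_mset p T) \<longleftrightarrow> admissible (?g w) T" for w T
    by (simp add: admissible_def image_mset.compositionality comp_def)
  have "triple_polytope S \<subseteq> ?g ` triple_polytope (image_mset (image_mset p) S)"
  proof
    fix w assume w: "w \<in> triple_polytope S"
    have g: "?g (\<chi> i. w $ inv p i) = w"
      using p by (simp add: vec_eq_iff permutes_inverses)
    then have "(\<chi> i. w $ inv p i) \<in> triple_polytope (image_mset (image_mset p) S)"
      using w by (simp add: triple_polytope_def adm)
    then show "w \<in> ?g ` triple_polytope (image_mset (image_mset p) S)"
      by (rule image_eqI[where f = ?g, OF g[symmetric]])
  qed
  then have "triple_polytope S = ?g ` triple_polytope (image_mset (image_mset p) S)"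
    by (auto simp: triple_polytope_def adm)
  then show ?thesis
    using scissors_permute_coordinates[OF polytope_triple_polytope[OF S'] p] by (simp only:)
qed

lemma equidissectable_relabel:
  fixes S :: "'m::finite multiset multiset"
  assumes p: "p permutes UNIV" and S: "trivalent S" and S': "trivalent (image_mset (image_mset p) S)"
  shows "equidissectable S (image_mset (image_mset p) S)"
proof -
  have "inv p \<circ> p = id" using p by (rule permutes_inv_o)
  then have "image_mset (inv p) (image_mset p T) = T" for T
    by (simp only: multiset.map_comp multiset.map_id0 id_apply)
  then have "image_mset (image_mset (inv p)) (image_mset (image_mset p) S) = S"
    by (simp add: multiset.map_comp comp_def)
  then show ?thesis
    using scissors_relabel[OF p S'] scissors_relabel[OF permutes_inv[OF p], of "image_mset (image_mset p) S"] S
    unfolding equidissectable_def by (simp only:)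
qed

section \<open>Combs\<close>

text \<open>Any two arrangements of a multiset are joined by exchanges of neighbours.\<close>

lemma mset_eq_adjacent_swap_induct [consumes 1, case_names refl swap trans]:
  assumes eq: "mset xs = mset ys"
    and refl: "\<And>xs. P xs xs"
    and swap: "\<And>us x y vs. P (us @ x # y # vs) (us @ y # x # vs)"
    and trans: "\<And>xs ys zs. P xs ys \<Longrightarrow> P ys zs \<Longrightarrow> P xs zs"
  shows "P xs ys"
proof -
  have bubble: "P (us @ x # vs @ ws) (us @ vs @ x # ws)" for us x vs ws
  proof (induction vs arbitrary: us)
    case Nil
    show ?case by (simp add: refl)
  next
    case (Cons v vs)
    have "P (us @ x # v # vs @ ws) (us @ v # x # vs @ ws)" by (rule swap)
    moreover have "P (us @ v # x # vs @ ws) (us @ v # vs @ x # ws)"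
      using Cons.IH[of "us @ [v]"] by simp
    ultimately have "P (us @ x # v # vs @ ws) (us @ v # vs @ x # ws)" by (rule trans)
    then show ?case by simp
  qed
  have "P (us @ xs) (us @ ys)" for us
    using eq
  proof (induction xs arbitrary: us ys)
    case Nil
    then show ?case by (simp add: refl)
  next
    case (Cons x xs)
    have "x \<in> set ys" unfolding mset_eq_setD[OF Cons.prems, symmetric] by simp
    from split_list[OF this] obtain ys1 ys2 where ys: "ys = ys1 @ x # ys2" by (elim exE)
    have "mset xs = mset (ys1 @ ys2)" using Cons.prems unfolding ys by simp
    from Cons.IH[OF this, of "us @ [x]"] have "P (us @ x # xs) (us @ x # ys1 @ ys2)" by simp
    from trans[OF this bubble[of us x ys1 ys2]] show ?case unfolding ys .
  qed
  from this[of "[]"] show ?thesis by simp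
qed

text \<open>The comb with internal edges \<open>fs\<close> and ends \<open>xs\<close>: its triples are \<open>{f1, x1, x2}\<close>, then
  \<open>{f2, f1, x3}\<close>, \<open>{f3, f2, x4}\<close> and so on, and the last internal edge is in a triple with the last
  two ends. The recursion replaces the first two ends by the internal edge that carries them. Combs proper
  have three more ends than internal edges; other arguments are given meaningless values.\<close>

fun comb :: "'m list \<Rightarrow> 'm list \<Rightarrow> 'm multiset multiset" where
  "comb [] xs = {#mset xs#}"
| "comb (f # fs) (x # y # xs) = add_mset {#f, x, y#} (comb fs (f # xs))"
| "comb _ _ = {#}"

lemma sum_comb:
  "length xs = length fs + 3 \<Longrightarrow> \<Sum>\<^sub># (comb fs xs) = mset xs + mset fs + mset fs"
  by (induction fs xs rule: comb.induct) auto


lemma size_in_comb: "length xs = length fs + 3 \<Longrightarrow> T \<in># comb fs xs \<Longrightarrow> size T = 3"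
  by (induction fs xs rule: comb.induct) auto

lemma comb_map:
  "length xs = length fs + 3 \<Longrightarrow>
     comb (map p fs) (map p xs) = image_mset (image_mset p) (comb fs xs)"
  by (induction fs xs rule: comb.induct) auto

text \<open>The first two ends lie in a common triple, as do the last two, and exchanging them changes
  nothing. Any other neighbours lie in the two triples at an internal edge, and exchanging
  them is a flip of this edge.\<close>

lemma equidissectable_comb_swap:
  assumes "length us + length vs = length fs + 1"
    and "trivalent (comb fs (us @ x # y # vs) + X)"
  shows "equidissectable (comb fs (us @ x # y # vs) + X) (comb fs (us @ y # x # vs) + X)"
  using assms
proof (induction fs arbitrary: us X)
  case Nil
  have "mset (us @ x # y # vs) = mset (us @ y # x # vs)" by simp
  with Nil show ?case by (simp only: comb.simps equidissectable_refl)
next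
  case (Cons f fs)
  consider "us = []" | u where "us = [u]" | u u' us' where "us = u # u' # us'"
    using that by (cases us; cases "tl us") auto
  then show ?case
  proof cases
    case 1
    have "{#f, x, y#} = {#f, y, x#}" by simp
    then have "comb (f # fs) (us @ x # y # vs) = comb (f # fs) (us @ y # x # vs)"
      unfolding 1 append_Nil comb.simps by simp
    then show ?thesis using equidissectable_refl[OF Cons.prems(2)] by (simp only:)
  next
    case (2 u)
    obtain g z R where *: "comb fs (f # x # vs) = add_mset {#f, x, g#} R"
      "comb fs (f # y # vs) = add_mset {#f, y, g#} R"
    proof (cases fs)
      case Nil
      then obtain v where "vs = [v]" using Cons.prems(1) 2 by (auto simp: length_Suc_conv)
      then show ?thesis using that Nil by simp
    next
      case (Cons g gs)
      then show ?thesis using that[of g] by (simp add: add_mset_commute)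
    qed
    have l: "comb (f # fs) (us @ x # y # vs) + X = add_mset {#f, u, x#} (add_mset {#f, y, g#} (R + X))"
      and r: "comb (f # fs) (us @ y # x # vs) + X = add_mset {#f, u, y#} (add_mset {#f, x, g#} (R + X))"
      by (simp_all add: 2 *)
    show ?thesis
      using equidissectable_interchange[of f u x y g "R + X"] Cons.prems(2) unfolding l r by simp
  next
    case (3 u u' us')
    have "comb (f # fs) (us @ zs) + X = comb fs ((f # us') @ zs) + add_mset {#f, u, u'#} X" for zs
      by (simp add: 3)
    then show ?thesis
      using Cons.IH[of "f # us'" "add_mset {#f, u, u'#} X"] Cons.prems 3 by simp
  qed
qed

text \<open>The hypothesis is part of the conclusion because composing two rearrangements uses that the one in
  the middle has the same ends.\<close>

lemma equidissectable_comb_permute: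
  assumes "mset xs = mset ys"
  shows "mset xs = mset ys \<and> (length xs = length fs + 3 \<longrightarrow> trivalent (comb fs xs + X) \<longrightarrow>
    equidissectable (comb fs xs + X) (comb fs ys + X))"
  using assms
proof (induction rule: mset_eq_adjacent_swap_induct)
  case (refl xs)
  show ?case by (simp add: equidissectable_refl)
next
  case (swap us x y vs)
  show ?case
  proof (intro conjI impI)
    show "equidissectable (comb fs (us @ x # y # vs) + X) (comb fs (us @ y # x # vs) + X)"
      if "length (us @ x # y # vs) = length fs + 3" "trivalent (comb fs (us @ x # y # vs) + X)"
      using that by (intro equidissectable_comb_swap) simp_all
  qed simp
next
  case (trans xs ys zs)
  show ?case
  proof (intro conjI impI)
    show "mset xs = mset zs" using trans by simp
    assume len: "length xs = length fs + 3" and tri: "trivalent (comb fs xs + X)"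
    have len': "length ys = length fs + 3" using trans len mset_eq_length[of xs ys] by simp
    have "trivalent (comb fs ys + X)"
    proof (rule trivalent_cong[OF tri])
      show "\<Sum>\<^sub># (comb fs ys + X) = \<Sum>\<^sub># (comb fs xs + X)"
        using trans len len' by (simp add: sum_comb)
      show "size T = 3" if "T \<in># comb fs ys + X" for T
        using that tri size_in_comb[OF len'] by (auto simp: trivalent_def)
    qed
    then have "equidissectable (comb fs ys + X) (comb fs zs + X)" using trans len' by simp
    moreover have "equidissectable (comb fs xs + X) (comb fs ys + X)" using trans len tri by simp
    ultimately show "equidissectable (comb fs xs + X) (comb fs zs + X)"
      using equidissectable_trans by metis
  qed
qed

text \<open>Connectedness of the underlying graph, in terms of triples.\<close>

definition linked :: "'m multiset multiset \<Rightarrow> bool" where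
  "linked S \<longleftrightarrow> (\<forall>A B. S = A + B \<longrightarrow> A \<noteq> {#} \<longrightarrow> B \<noteq> {#} \<longrightarrow> \<Sum>\<^sub># A \<inter># \<Sum>\<^sub># B \<noteq> {#})"

text \<open>The set \<open>X\<close> of triples not yet absorbed is a part of the original \<open>S\<close>, and the comb has the same
  edge occurrences as the absorbed part \<open>A\<close>. Hence connectedness of \<open>S\<close> can be used at every step, and
  need not be followed through the flips. An edge shared by \<open>A\<close> and \<open>X\<close> occurs only once in \<open>A\<close>,
  whereas internal edges of the comb occur twice; so it is an end.\<close>

lemma partial_comb:
  fixes S :: "'m::finite multiset multiset"
  assumes S: "trivalent S" "linked S" and "k < size S"
  shows "\<exists>A X fs xs. S = A + X \<and> length fs = k \<and> length xs = k + 3 \<and>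
    \<Sum>\<^sub># (comb fs xs) = \<Sum>\<^sub># A \<and> size A = Suc k \<and> equidissectable S (comb fs xs + X)"
  using \<open>k < size S\<close>
proof (induction k)
  case 0
  then obtain T X where TX: "S = add_mset T X" by (metis less_irrefl size_empty multiset_cases)
  then have "size T = 3" using S by (simp add: trivalent_def)
  then obtain a b c where "T = {#a, b, c#}" by (rule size_3_multiset)
  then have "S = {#T#} + X \<and> length [] = (0::nat) \<and> length [a, b, c] = 0 + 3 \<and>
    \<Sum>\<^sub># (comb [] [a, b, c]) = \<Sum>\<^sub># {#T#} \<and> size {#T#} = Suc 0 \<and>
    equidissectable S (comb [] [a, b, c] + X)"
    using equidissectable_refl[OF S(1)] TX by simp
  then show ?case by (intro exI)
next
  case (Suc k)
  then have "k < size S" by simp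
  from Suc.IH[OF this] obtain A X fs xs where S_eq: "S = A + X" and len: "length fs = k" "length xs = k + 3"
    and sum: "\<Sum>\<^sub># (comb fs xs) = \<Sum>\<^sub># A" and sA: "size A = Suc k"
    and equi: "equidissectable S (comb fs xs + X)"
    by (elim exE conjE)
  have "X \<noteq> {#}" "A \<noteq> {#}" using S_eq sA Suc.prems by auto
  then have "\<Sum>\<^sub># A \<inter># \<Sum>\<^sub># X \<noteq> {#}" using S(2) S_eq unfolding linked_def by blast
  then obtain e where e: "e \<in># \<Sum>\<^sub># A" "e \<in># \<Sum>\<^sub># X" by (metis multiset_nonemptyE inter_iff)
  have sumA: "\<Sum>\<^sub># A = mset xs + mset fs + mset fs" using sum sum_comb[of xs fs] len by simp
  have "count (\<Sum>\<^sub># A) e + count (\<Sum>\<^sub># X) e \<le> 2" using S(1) by (simp add: S_eq trivalent_def)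
  moreover have "count (\<Sum>\<^sub># X) e \<ge> 1" using e(2) by (simp only: count_greater_eq_one_iff)
  ultimately have "count (\<Sum>\<^sub># A) e \<le> 1" by linarith
  have "e \<notin> set fs"
  proof
    assume "e \<in> set fs"
    then have "count (mset fs) e \<noteq> 0" by (simp only: count_mset_0_iff not_not simp_thms)
    then show False using \<open>count (\<Sum>\<^sub># A) e \<le> 1\<close> unfolding sumA count_union by linarith
  qed
  then have "e \<in># mset xs" using e(1) unfolding sumA by auto
  then obtain zs where zs: "mset xs = mset (e # zs)" by (metis insert_DiffM ex_mset mset.simps(2))
  obtain T where "T \<in># X" "e \<in># T" using e(2) by auto
  then obtain X' where X': "X = add_mset T X'" by (metis insert_DiffM)
  obtain T' where "T = add_mset e T'" using \<open>e \<in># T\<close> by (metis insert_DiffM)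
  moreover have "size T = 3" using S(1) \<open>T \<in># X\<close> by (simp add: S_eq trivalent_def)
  ultimately have "size T' = 2" by simp
  then obtain y T'' where "T' = add_mset y T''" "size T'' = 1" by (cases T') auto
  then obtain z where T: "T = {#e, y, z#}"
    using \<open>T = add_mset e T'\<close> size_1_singleton_mset[of T''] by auto
  have tri: "trivalent (comb fs xs + X)"
  proof (rule trivalent_cong[OF S(1)])
    show "\<Sum>\<^sub># (comb fs xs + X) = \<Sum>\<^sub># S" using sum S_eq by simp
    show "size T = 3" if "T \<in># comb fs xs + X" for T
      using that S(1) size_in_comb[of xs fs] len by (auto simp: trivalent_def S_eq)
  qed
  have "equidissectable (comb fs xs + X) (comb fs (e # zs) + X)"
    using equidissectable_comb_permute[OF zs, of fs X] len tri by simp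
  \<comment> \<open>The end \<open>e\<close>, now in front, becomes the internal edge that attaches its other triple \<open>T\<close>.\<close>
  also have "comb fs (e # zs) + X = comb (e # fs) (y # z # zs) + X'"
    by (simp add: X' T)
  finally have "equidissectable S (comb (e # fs) (y # z # zs) + X')"
    by (rule equidissectable_trans[OF equi])
  moreover have "length zs = k + 2" using mset_eq_length[OF zs] len by simp
  moreover have "\<Sum>\<^sub># (comb (e # fs) (y # z # zs)) = \<Sum>\<^sub># (add_mset T A)"
    using sum_comb[of "y # z # zs" "e # fs"] \<open>length zs = k + 2\<close> len zs by (simp add: sumA T)
  ultimately have "S = add_mset T A + X' \<and> length (e # fs) = Suc k \<and>
      length (y # z # zs) = Suc k + 3 \<and>
      \<Sum>\<^sub># (comb (e # fs) (y # z # zs)) = \<Sum>\<^sub># (add_mset T A) \<and> size (add_mset T A) = Suc (Suc k) \<and>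
      equidissectable S (comb (e # fs) (y # z # zs) + X')"
    using len sA by (simp add: S_eq X')
  then show ?case by (intro exI)
qed

lemma equidissectable_comb:
  fixes S :: "'m::finite multiset multiset"
  assumes S: "trivalent S" "linked S" "S \<noteq> {#}"
  obtains fs xs where "length xs = length fs + 3" "size S = Suc (length fs)"
    "trivalent (comb fs xs)" "equidissectable S (comb fs xs)"
proof -
  have "size S - 1 < size S" using S by (simp add: nonempty_has_size)
  from partial_comb[OF S(1,2) this]
  obtain A X fs xs where SAX: "S = A + X" and len: "length fs = size S - 1" "length xs = size S - 1 + 3"
    and sum: "\<Sum>\<^sub># (comb fs xs) = \<Sum>\<^sub># A" and sA: "size A = Suc (size S - 1)"
    and equi: "equidissectable S (comb fs xs + X)"
    by (elim exE conjE)
  have sS: "Suc (size S - 1) = size S" using S(3) by (simp add: nonempty_has_size)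
  moreover have "size S = size A + size X" unfolding SAX by (rule size_union)
  ultimately have "size X = 0" using sA by linarith
  then have X: "X = {#}" by simp
  have len': "length xs = length fs + 3" using len by simp
  show ?thesis
  proof (rule that)
    have "\<Sum>\<^sub># (comb fs xs) = \<Sum>\<^sub># S" unfolding sum using SAX X by simp
    then show "trivalent (comb fs xs)"
      by (rule trivalent_cong[OF S(1)]) (rule size_in_comb[OF len'])
    show "size S = Suc (length fs)" using len(1) sS by linarith
    show "equidissectable S (comb fs xs)" using equi X by simp
  qed (rule len')
qed

section \<open>Combs with equally many triples\<close>

text \<open>The internal edges have to be matched in order, as the comb depends on the order of its list
  of internal edges.\<close>

lemma bij_betw_nth_pairs:
  assumes "distinct xs" "distinct ys" "length xs = length ys"
  obtains f where "bij_betw f (set xs) (set ys)" "map f xs = ys"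
proof -
  let ?i = "inv_into {..<length xs} ((!) xs)"
  have xs: "bij_betw ((!) xs) {..<length xs} (set xs)" and ys: "bij_betw ((!) ys) {..<length xs} (set ys)"
    using assms by (auto intro: bij_betw_nth)
  have "bij_betw ((!) ys \<circ> ?i) (set xs) (set ys)"
    using bij_betw_inv_into[OF xs] ys by (rule bij_betw_trans)
  moreover have "map ((!) ys \<circ> ?i) xs = ys"
  proof (rule nth_equalityI)
    fix i assume "i < length (map ((!) ys \<circ> ?i) xs)"
    then show "map ((!) ys \<circ> ?i) xs ! i = ys ! i"
      using bij_betw_inv_into_left[OF xs, of i] by simp
  qed (simp add: assms)
  ultimately show ?thesis by (rule that)
qed

text \<open>Every edge label is internal, a double end or a single end, and counting ends and labels leaves
  two linear equations that determine the numbers of double and single ends.\<close>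

lemma comb_labels:
  fixes fs xs :: "'m::finite list"
  assumes len: "length xs = length fs + 3" and tri: "trivalent (comb fs xs)"
  defines "D \<equiv> {e. count (mset xs) e = 2}" and "L \<equiv> {e. count (mset xs) e = 1}"
  shows "distinct fs" "set fs = - (D \<union> L)" "2 * card D + card L = length xs"
    "card D + card L + length fs = CARD('m)"
proof -
  have sum: "count (mset xs) e + 2 * count (mset fs) e \<in> {1, 2}" for e
  proof -
    have "1 \<le> count (\<Sum>\<^sub># (comb fs xs)) e \<and> count (\<Sum>\<^sub># (comb fs xs)) e \<le> 2"
      using tri unfolding trivalent_def by blast
    then have "1 \<le> count (mset xs) e + 2 * count (mset fs) e \<and> count (mset xs) e + 2 * count (mset fs) e \<le> 2"
      unfolding sum_comb[OF len] count_union by linarith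
    then show ?thesis by auto
  qed
  have fs1: "count (mset fs) e \<le> 1" for e using sum[of e] by auto
  have fs: "e \<in> set fs \<longleftrightarrow> count (mset fs) e = 1" for e
  proof -
    have "count (mset fs) e = 0 \<longleftrightarrow> e \<notin> set fs" by (rule count_mset_0_iff)
    then show ?thesis using fs1[of e] by linarith
  qed
  show "distinct fs" unfolding distinct_count_atmost_1
  proof
    fix a
    have "count (mset fs) a = 0 \<or> count (mset fs) a = 1" using fs1[of a] by linarith
    then show "count (mset fs) a = (if a \<in> set fs then 1 else 0)" using fs[of a] by auto
  qed
  then have card_fs: "card (set fs) = length fs" by (rule distinct_card)
  have "e \<in> set fs \<longleftrightarrow> e \<notin> D \<union> L" for e
    unfolding fs D_def L_def using sum[of e] by auto
  then show set_fs: "set fs = - (D \<union> L)" by blast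
  have disj: "D \<inter> L = {}" by (auto simp: D_def L_def)
  have "length xs = (\<Sum>e\<in>UNIV. count (mset xs) e)"
    using size_multiset_overloaded_eq[of "mset xs"] sum.mono_neutral_left[of UNIV "set_mset (mset xs)" "count (mset xs)"]
    by (simp add: count_mset_0_iff)
  also have "\<dots> = (\<Sum>e\<in>UNIV. (if e \<in> D then 2 else 0) + (if e \<in> L then 1 else 0))"
  proof (rule sum.cong[OF refl])
    fix e show "count (mset xs) e = (if e \<in> D then 2 else 0) + (if e \<in> L then 1 else 0)"
    proof -
      have "count (mset xs) e = 0 \<or> count (mset xs) e = 1 \<or> count (mset xs) e = 2"
        using sum[of e] unfolding insert_iff empty_iff by arith
      then show ?thesis
        unfolding D_def L_def by (elim disjE) (simp_all del: count_mset_0_iff)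
    qed
  qed
  also have "\<dots> = 2 * card D + card L"
    by (simp add: sum.distrib sum.If_cases)
  finally show "2 * card D + card L = length xs" by simp
  have "card (D \<union> L) + card (set fs) = CARD('m)"
    using card_Un_disjoint[OF finite finite Compl_disjoint, of "D \<union> L"]
    unfolding set_fs Compl_partition by (rule sym)
  then show "card D + card L + length fs = CARD('m)"
    using disj by (simp add: card_Un_disjoint card_fs)
qed

text \<open>Choose a permutation of the labels that matches internal edges in order, double ends with double
  ends and single ends with single ends. It carries one comb to the other up to the order of the
  ends.\<close>

lemma equidissectable_combs:
  fixes fs xs fs' xs' :: "'m::finite list"
  assumes len: "length xs = length fs + 3" "length xs' = length fs' + 3" "length fs = length fs'"
    and tri: "trivalent (comb fs xs)" and tri': "trivalent (comb fs' xs')"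
  shows "equidissectable (comb fs xs) (comb fs' xs')"
proof -
  define D where "D xs = {e. count (mset xs) e = 2}" for xs :: "'m list"
  define L where "L xs = {e. count (mset xs) e = 1}" for xs :: "'m list"
  note c = comb_labels[OF len(1) tri, folded D_def L_def]
  note c' = comb_labels[OF len(2) tri', folded D_def L_def]
  have "card (D xs) = card (D xs')" "card (L xs) = card (L xs')"
    using c(3,4) c'(3,4) len by linarith+
  then obtain g h where g: "bij_betw g (D xs) (D xs')" and h: "bij_betw h (L xs) (L xs')"
    using finite_same_card_bij[of "D xs" "D xs'"] finite_same_card_bij[of "L xs" "L xs'"] by auto
  obtain f where f: "bij_betw f (set fs) (set fs')" "map f fs = fs'"
    using bij_betw_nth_pairs[OF c(1) c'(1) len(3)] .
  define p where "p e = (if e \<in> D xs \<union> L xs then if e \<in> D xs then g e else h e else f e)" for e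
  have DL: "D zs \<inter> L zs = {}" for zs by (auto simp: D_def L_def)
  have "bij_betw p ((D xs \<union> L xs) \<union> set fs) ((D xs' \<union> L xs') \<union> set fs')"
    unfolding p_def
    by (intro bij_betw_disjoint_Un g h f(1)) (use DL c(2) c'(2) in auto)
  moreover have "(D xs \<union> L xs) \<union> set fs = UNIV" "(D xs' \<union> L xs') \<union> set fs' = UNIV"
    unfolding c(2) c'(2) by (rule Compl_partition)+
  ultimately have "bij p" by (simp only:)
  then have perm: "p permutes UNIV" by (rule bij_imp_permutes) auto
  have pD: "p e \<in> D xs'" if "e \<in> D xs" for e using that g by (auto simp: p_def bij_betw_def)
  have pL: "p e \<in> L xs'" if "e \<in> L xs" for e using that h DL[of xs] by (auto simp: p_def bij_betw_def)
  have pf: "p e = f e" if "e \<in> set fs" for e using that c(2) by (auto simp: p_def)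
  have "map p fs = map f fs" using pf by (simp cong: map_cong)
  then have p_fs: "map p fs = fs'" using f(2) by simp
  have p_count: "count (mset xs') (p e) = count (mset xs) e" for e
  proof -
    consider "e \<in> D xs" | "e \<in> L xs" | "e \<in> set fs" using c(2) by blast
    then show ?thesis
    proof cases
      case 1 then show ?thesis using pD[OF 1] by (simp add: D_def)
    next
      case 2 then show ?thesis using pL[OF 2] by (simp add: L_def)
    next
      case 3
      have "p e \<in> set fs'" using 3 p_fs by (metis image_eqI set_map)
      have zero: "count (mset zs) x = 0" if "length zs = length gs + 3" "trivalent (comb gs zs)" "x \<in> set gs"
        for zs gs :: "'m list" and x
      proof -
        have "count (\<Sum>\<^sub># (comb gs zs)) x \<le> 2" using that(2) unfolding trivalent_def by blast
        moreover have "count (mset gs) x \<noteq> 0" using that(3) by (simp only: count_mset_0_iff not_not simp_thms)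
        ultimately show ?thesis unfolding sum_comb[OF that(1)] count_union by linarith
      qed
      show ?thesis using zero[OF len(1) tri 3] zero[OF len(2) tri' \<open>p e \<in> set fs'\<close>] by (simp only:)
    qed
  qed
  have mset: "mset (map p xs) = mset xs'"
  proof (rule multiset_eqI)
    fix y
    obtain e where y: "y = p e" using \<open>bij p\<close> by (metis bij_pointE)
    have "inj p" using \<open>bij p\<close> by (rule bij_is_inj)
    then have "count (mset (map p xs)) (p e) = count (mset xs) e"
      by (induction xs) (simp_all add: inj_eq)
    then show "count (mset (map p xs)) y = count (mset xs') y" unfolding y p_count .
  qed
  have relabelled: "image_mset (image_mset p) (comb fs xs) = comb fs' (map p xs)"
    using comb_map[OF len(1), of p] p_fs by simp
  have lenp: "length (map p xs) = length fs' + 3" using len by simp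
  have trip: "trivalent (comb fs' (map p xs))"
  proof (rule trivalent_cong[OF tri'])
    show "\<Sum>\<^sub># (comb fs' (map p xs)) = \<Sum>\<^sub># (comb fs' xs')"
      using mset sum_comb[OF lenp] sum_comb[OF len(2)] by simp
  qed (rule size_in_comb[OF lenp])
  have "equidissectable (comb fs xs) (comb fs' (map p xs))"
    using equidissectable_relabel[OF perm tri] trip unfolding relabelled .
  also have "equidissectable (comb fs' (map p xs)) (comb fs' xs')"
    using equidissectable_comb_permute[OF mset, of fs' "{#}"] lenp trip by simp
  finally show ?thesis .
qed

lemma scissors_trivalent:
  fixes S S' :: "'m::finite multiset multiset"
  assumes "trivalent S" "linked S" "S \<noteq> {#}" and "trivalent S'" "linked S'" "S' \<noteq> {#}"
    and "size S = size S'"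
  shows "scissors (triple_polytope S) (triple_polytope S')"
proof -
  obtain fs xs where 1: "length xs = length fs + 3" "size S = Suc (length fs)"
      "trivalent (comb fs xs)" "equidissectable S (comb fs xs)"
    using equidissectable_comb[OF assms(1-3)] .
  obtain fs' xs' where 2: "length xs' = length fs' + 3" "size S' = Suc (length fs')"
      "trivalent (comb fs' xs')" "equidissectable S' (comb fs' xs')"
    using equidissectable_comb[OF assms(4-6)] .
  have "length fs = length fs'" using 1(2) 2(2) assms(7) by simp
  then have "equidissectable (comb fs xs) (comb fs' xs')"
    using equidissectable_combs 1(1,3) 2(1,3) by blast
  then have "equidissectable S S'"
    using 1(4) 2(4) equidissectable_trans equidissectable_sym by metis
  then show ?thesis by (simp add: equidissectable_def)
qed

section \<open>From graphs to systems of triples\<close>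

definition triples :: "('v, 'm::finite) mgraph \<Rightarrow> 'm multiset multiset" where
  "triples G = image_mset (incident_edges G) (mset_set {v \<in> verts G. vertex_degree G v = 3})"

lemma count_incident_edges: "count (incident_edges G v) e = count (ends G e) v"
  by (simp add: incident_edges_def count_sum sum.delta)

lemma in_incident_edges_iff: "e \<in># incident_edges G v \<longleftrightarrow> v \<in># ends G e"
  by (simp only: count_incident_edges flip: count_greater_zero_iff)

lemma in_triples_iff:
  assumes "one_three_graph G"
  shows "T \<in># triples G \<longleftrightarrow> (\<exists>v\<in>verts G. vertex_degree G v = 3 \<and> T = incident_edges G v)"
proof -
  have "finite (verts G)" using assms by (simp add: one_three_graph_def wf_mgraph_def)
  then show ?thesis by (auto simp: triples_def)
qed

lemma graph_polytope_eq_triple_polytope: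
  assumes "one_three_graph G"
  shows "graph_polytope G = triple_polytope (triples G)"
proof (intro equalityI subsetI)
  fix w assume w: "w \<in> graph_polytope G"
  have "admissible w (incident_edges G v)" if v: "v \<in> verts G" "vertex_degree G v = 3" for v
  proof -
    obtain a b c where "incident_edges G v = {#a, b, c#}"
      using v(2) size_3_multiset unfolding vertex_degree_def by blast
    then show ?thesis using w v(1) by (auto simp: graph_polytope_def admissible_triple)
  qed
  then show "w \<in> triple_polytope (triples G)"
    by (auto simp: triple_polytope_def in_triples_iff[OF assms])
next
  fix w assume w: "w \<in> triple_polytope (triples G)"
  have "w $ a + w $ b + w $ c \<le> 1 \<and> w $ a \<le> w $ b + w $ c \<and> w $ b \<le> w $ a + w $ c \<and>
      w $ c \<le> w $ a + w $ b" if "v \<in> verts G" "incident_edges G v = {#a, b, c#}" for v a b c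
  proof -
    have "vertex_degree G v = 3" using that by (simp add: vertex_degree_def)
    then have "{#a, b, c#} \<in># triples G" using that in_triples_iff[OF assms] by metis
    then show ?thesis using w by (simp add: triple_polytope_def flip: admissible_triple)
  qed
  then show "w \<in> graph_polytope G" by (simp add: graph_polytope_def)
qed

lemma connected_mgraph_closure:
  assumes G: "connected_mgraph G" and u: "u \<in> verts G" "u \<in> W"
    and closed: "\<And>x y e. x \<in> W \<Longrightarrow> ends G e = {#x, y#} \<Longrightarrow> y \<in> W"
  shows "verts G \<subseteq> W"
proof
  fix v assume "v \<in> verts G"
  then have "(u, v) \<in> (adjacency G)\<^sup>*" using G u by (simp add: connected_mgraph_def)
  then show "v \<in> W"
  proof (induction rule: rtrancl_induct)
    case (step x y)
    then show ?case using closed by (auto simp: adjacency_def)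
  qed (rule u(2))
qed

text \<open>An edge between two vertices of degree one would be a whole connected component.\<close>

lemma edge_has_degree_three_end:
  assumes G: "one_three_graph G" "connected_mgraph G" and ex: "\<exists>v\<in>verts G. vertex_degree G v = 3"
  shows "\<exists>v\<in>verts G. vertex_degree G v = 3 \<and> v \<in># ends G e"
proof (rule ccontr)
  assume contra: "\<not> ?thesis"
  have wf: "set_mset (ends G e) \<subseteq> verts G" "size (ends G e) = 2"
    using G(1) by (auto simp: one_three_graph_def wf_mgraph_def)
  have only: "e' = e" if "x \<in># ends G e" "x \<in># ends G e'" for x e'
  proof -
    have "vertex_degree G x = 1"
      using contra that(1) wf G(1) unfolding one_three_graph_def by blast
    then obtain d where "incident_edges G x = {#d#}"
      unfolding vertex_degree_def using size_1_singleton_mset by blast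
    then show ?thesis
      using that unfolding in_incident_edges_iff[symmetric] by simp
  qed
  obtain u where u: "u \<in># ends G e" using wf(2) by fastforce
  have "verts G \<subseteq> set_mset (ends G e)"
  proof (rule connected_mgraph_closure[OF G(2)])
    show "y \<in># ends G e" if "x \<in># ends G e" "ends G e' = {#x, y#}" for x y e'
      using only[of x e'] that by simp
  qed (use u wf in auto)
  then show False using ex contra by blast
qed

lemma trivalent_triples:
  assumes G: "one_three_graph G" "connected_mgraph G" and ex: "\<exists>v\<in>verts G. vertex_degree G v = 3"
  shows "trivalent (triples G)"
  unfolding trivalent_def
proof (intro conjI allI ballI)
  let ?V = "{v \<in> verts G. vertex_degree G v = 3}"
  have fin: "finite ?V" using G(1) by (simp add: one_three_graph_def wf_mgraph_def)
  show "size T = 3" if "T \<in># triples G" for T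
    using that by (auto simp: in_triples_iff[OF G(1)] vertex_degree_def)
  fix e
  have sum: "count (\<Sum>\<^sub># (triples G)) e = (\<Sum>v\<in>?V. count (ends G e) v)"
    by (simp add: triples_def count_sum count_incident_edges flip: sum_unfold_sum_mset)
  also have "\<dots> \<le> (\<Sum>v\<in>?V \<union> set_mset (ends G e). count (ends G e) v)"
    using fin by (intro sum_mono2) auto
  also have "\<dots> = (\<Sum>v\<in>set_mset (ends G e). count (ends G e) v)"
    using fin by (intro sum.mono_neutral_right) (auto simp: count_eq_zero_iff)
  also have "\<dots> = 2"
    using G(1) by (simp add: one_three_graph_def wf_mgraph_def flip: size_multiset_overloaded_eq)
  finally show "count (\<Sum>\<^sub># (triples G)) e \<le> 2" .
  obtain v where "v \<in> ?V" "v \<in># ends G e" using edge_has_degree_three_end[OF G ex] by blast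
  then have "1 \<le> count (ends G e) v" "count (ends G e) v \<le> (\<Sum>v\<in>?V. count (ends G e) v)"
    using fin by (auto intro: member_le_sum)
  then show "1 \<le> count (\<Sum>\<^sub># (triples G)) e" unfolding sum by linarith
qed

text \<open>The vertices that meet an edge of \<open>A\<close> are closed under adjacency if \<open>A\<close> and \<open>B\<close> share no edge: a
  vertex of degree three that meets an edge of \<open>A\<close> must then have its triple in \<open>A\<close>, and the only
  edge at a vertex of degree one is the edge of \<open>A\<close> that it meets. So they are all the
  vertices, including the one of a triple in \<open>B\<close>.\<close>

lemma linked_triples:
  assumes G: "one_three_graph G" "connected_mgraph G"
  shows "linked (triples G)"
  unfolding linked_def
proof (intro allI impI notI)
  fix A B
  assume AB: "triples G = A + B" "A \<noteq> {#}" "B \<noteq> {#}" and "\<Sum>\<^sub># A \<inter># \<Sum>\<^sub># B = {#}"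
  then have disj: "\<not> (e \<in># \<Sum>\<^sub># A \<and> e \<in># \<Sum>\<^sub># B)" for e
    by (metis empty_iff inter_iff set_mset_empty)
  have vertex: "\<exists>v\<in>verts G. vertex_degree G v = 3 \<and> T = incident_edges G v" if "T \<in># A + B" for T
    using that in_triples_iff[OF G(1)] AB(1) by metis
  define W where "W = {v. \<exists>e. v \<in># ends G e \<and> e \<in># \<Sum>\<^sub># A}"
  obtain T where T: "T \<in># A" using AB(2) by blast
  then obtain u where u: "u \<in> verts G" "vertex_degree G u = 3" "T = incident_edges G u"
    using vertex by auto
  then obtain e where "e \<in># T" unfolding vertex_degree_def by (metis multiset_nonemptyE size_empty zero_neq_numeral)
  then have "e \<in># incident_edges G u" "e \<in># \<Sum>\<^sub># A" using u(3) T by auto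
  then have "u \<in> W" unfolding W_def in_incident_edges_iff by blast
  have "verts G \<subseteq> W"
  proof (rule connected_mgraph_closure[OF G(2) u(1) \<open>u \<in> W\<close>])
    fix x y e' assume "x \<in> W" and e': "ends G e' = {#x, y#}"
    then obtain e where e: "e \<in># incident_edges G x" "e \<in># \<Sum>\<^sub># A"
      unfolding W_def in_incident_edges_iff by blast
    have e'x: "e' \<in># incident_edges G x" using e' by (simp add: in_incident_edges_iff)
    have "x \<in># ends G e'" by (simp add: e')
    then have "x \<in> verts G" using G(1) unfolding one_three_graph_def wf_mgraph_def by blast
    then consider "vertex_degree G x = 1" | "vertex_degree G x = 3"
      using G(1) unfolding one_three_graph_def by blast
    then have "e' \<in># \<Sum>\<^sub># A"
    proof cases
      case 1
      then obtain d where "incident_edges G x = {#d#}"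
        unfolding vertex_degree_def using size_1_singleton_mset by blast
      then show ?thesis using e e'x by simp
    next
      case 2
      then have "incident_edges G x \<in># A + B"
        using \<open>x \<in> verts G\<close> in_triples_iff[OF G(1)] AB(1) by metis
      moreover have "incident_edges G x \<notin># B" using disj[of e] e by auto
      ultimately show ?thesis using e'x by auto
    qed
    moreover have "y \<in># ends G e'" by (simp add: e')
    ultimately show "y \<in> W" unfolding W_def by blast
  qed
  obtain T' where T': "T' \<in># B" using AB(3) by blast
  then obtain v where v: "v \<in> verts G" "vertex_degree G v = 3" "T' = incident_edges G v"
    using vertex by auto
  then have "incident_edges G v \<in># A + B" using T' by simp
  obtain e where e: "e \<in># incident_edges G v" "e \<in># \<Sum>\<^sub># A"
    using \<open>verts G \<subseteq> W\<close> v(1) unfolding W_def in_incident_edges_iff by blast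
  then show False using disj[of e] T' v(3) by auto
qed

text \<open>The handshake lemma: every degree is one, plus two at the vertices that carry a triple.\<close>

lemma size_triples:
  fixes G :: "('v, 'm::finite) mgraph"
  assumes "one_three_graph G"
  shows "card (verts G) + 2 * size (triples G) = 2 * CARD('m)"
proof -
  have fin: "finite (verts G)"
    and ends: "\<And>e. size (ends G e) = 2" "\<And>e. set_mset (ends G e) \<subseteq> verts G"
    and deg: "\<And>v. v \<in> verts G \<Longrightarrow> vertex_degree G v = 1 \<or> vertex_degree G v = 3"
    using assms by (auto simp: one_three_graph_def wf_mgraph_def)
  let ?V = "{v \<in> verts G. vertex_degree G v = 3}"
  have "(\<Sum>v\<in>verts G. vertex_degree G v) = (\<Sum>v\<in>verts G. 1 + (if vertex_degree G v = 3 then 2 else 0))"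
    using deg by (intro sum.cong) fastforce+
  also have "\<dots> = card (verts G) + (\<Sum>v\<in>verts G. if vertex_degree G v = 3 then 2 else 0)"
    by (simp only: sum.distrib card_eq_sum)
  also have "\<dots> = card (verts G) + 2 * card ?V"
    using fin by (simp add: sum.If_cases Int_def)
  finally have 1: "(\<Sum>v\<in>verts G. vertex_degree G v) = card (verts G) + 2 * card ?V" .
  have "(\<Sum>v\<in>verts G. vertex_degree G v) = (\<Sum>v\<in>verts G. \<Sum>e\<in>UNIV. count (ends G e) v)"
    by (simp add: vertex_degree_def incident_edges_def)
  also have "\<dots> = (\<Sum>e\<in>UNIV. \<Sum>v\<in>verts G. count (ends G e) v)" by (rule sum.swap)
  also have "\<dots> = (\<Sum>e\<in>UNIV. size (ends G e))"
  proof (rule sum.cong[OF refl])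
    fix e
    show "(\<Sum>v\<in>verts G. count (ends G e) v) = size (ends G e)"
      unfolding size_multiset_overloaded_eq
      using fin ends(2) by (intro sum.mono_neutral_right) (auto simp: count_eq_zero_iff)
  qed
  also have "\<dots> = 2 * CARD('m)" by (simp add: ends(1))
  finally show ?thesis using 1 by (simp add: triples_def)
qed

theorem theorem3:
  fixes G :: "('v, 'm::finite) mgraph" and G' :: "('w, 'm) mgraph"
  assumes "one_three_graph G" and "connected_mgraph G" and "\<exists>v\<in>verts G. vertex_degree G v = 3"
    and "one_three_graph G'" and "connected_mgraph G'" and "\<exists>v\<in>verts G'. vertex_degree G' v = 3"
    and "card (verts G) = card (verts G')"
  shows "\<exists>(k::nat) (P :: nat \<Rightarrow> (real ^ 'm) set) (U :: nat \<Rightarrow> real ^ 'm \<Rightarrow> real ^ 'm).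
           dissection {1..k} P (graph_polytope G) \<and>
           (\<forall>i\<in>{1..k}. affine_unimodular (U i)) \<and>
           graph_polytope G' = (\<Union>i\<in>{1..k}. U i ` P i)"
proof -
  have "triples G \<noteq> {#}" "triples G' \<noteq> {#}"
    using assms in_triples_iff[of G] in_triples_iff[of G'] by fastforce+
  moreover have "size (triples G) = size (triples G')"
    using size_triples[OF assms(1)] size_triples[OF assms(4)] assms(7) by simp
  ultimately have "scissors (triple_polytope (triples G)) (triple_polytope (triples G'))"
    using assms by (intro scissors_trivalent trivalent_triples linked_triples)
  then show ?thesis
    unfolding scissors_def graph_polytope_eq_triple_polytope[OF assms(1)]
      graph_polytope_eq_triple_polytope[OF assms(4)] .
qed

end
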